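(* Let $\mathbf{p}_n$ be a permutation of $[n]$ chosen uniformly at random. Then $$\lim_{n\to\infty}\Pr\big[\mathbf{p}_n \text{ contains a pair of twins of length at least } \tfrac{1}{80}n^{2/3}\big]=1.$$
   Context: A permutation of a finite set $\Sigma\subset\mathbb{N}$ is a sequence in which every element of $\Sigma$ appears exactly once; a subpermutation of a permutation is a subsequence of it. Two sequences $(a_1,\dots,a_L)$ and $(b_1,\dots,b_L)$ of distinct numbers are order-isomorphic if for all $i,j$: $a_i<a_j \iff b_i<b_j$. Two subpermutations of a permutation are called twins if they are order-isomorphic and disjoint (share no symbol); their length is their common number of entries. *)

theory Defs
  imports "HOL-Combinatorics.Multiset_Permutations" Complex_Main
begin

definition order_iso :: "nat list \<Rightarrow> nat list \<Rightarrow> bool" where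
  "order_iso a b \<longleftrightarrow> length a = length b \<and>
     (\<forall>i < length a. \<forall>j < length a. (a ! i < a ! j) \<longleftrightarrow> (b ! i < b ! j))"

definition has_twins_of_length_ge :: "nat list \<Rightarrow> real \<Rightarrow> bool" where
  "has_twins_of_length_ge p x \<longleftrightarrow>
     (\<exists>I J. I \<subseteq> {..<length p} \<and> J \<subseteq> {..<length p} \<and>
        set (nths p I) \<inter> set (nths p J) = {} \<and>
        length (nths p I) = length (nths p J) \<and>
        real (length (nths p I)) \<ge> x \<and>
        order_iso (nths p I) (nths p J))"

definition twin_prob :: "nat \<Rightarrow> real" where
  "twin_prob n = real (card {p \<in> permutations_of_set {1..n}.
        has_twins_of_length_ge p (real n powr (2/3) / 80)})
      / real (card (permutations_of_set {1..n}))"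

end

theory Submission
  imports Defs "HOL-Real_Asymp.Real_Asymp"
begin

text \<open>
  Cut positions and values into blocks of length \<open>L \<approx> n powr (1/3) / 2\<close>. If several pairs of entries
  each lie in one cell (position block times value block), and no two of these cells share a row or
  a column, then taking one entry from each pair gives one twin and the remaining entries give the
  other. The largest number of such pairs changes by at most 2 when two values are exchanged, so
  its variance is at most \<open>4 * n\<close>, by exposing the permutation one entry at a time. Its mean is at
  least the expected number of pairs in a common cell minus the expected number of conflicts between
  such pairs, which is about \<open>(1/8 - 1/16) * n powr (2/3)\<close>. Chebyshev's inequality concludes.
\<close>

section \<open>Variance of Lipschitz functions of a permutation\<close>

text \<open>Conditions on the first entry, the one exposed in each step of the variance
  induction.\<close>

lemma sum_permutations_of_set_Cons:
  assumes "finite A" "A \<noteq> {}"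
  shows "(\<Sum>p\<in>permutations_of_set A. g p) = (\<Sum>x\<in>A. \<Sum>q\<in>permutations_of_set (A - {x}). g (x # q))"
proof -
  have "(\<Sum>p\<in>permutations_of_set A. g p) = (\<Sum>x\<in>A. sum g ((#) x ` permutations_of_set (A - {x})))"
    unfolding permutations_of_set_nonempty[OF assms(2)]
    using assms(1) by (intro sum.UNION_disjoint) auto
  also have "\<dots> = (\<Sum>x\<in>A. \<Sum>q\<in>permutations_of_set (A - {x}). g (x # q))"
    by (rule sum.cong[OF refl]) (subst sum.reindex, auto)
  finally show ?thesis .
qed

text \<open>The cross term vanishes because deviations from the mean sum to zero. Used on one fibre
  with \<open>a\<close> the overall mean, this yields the law of total variance.\<close>

lemma sum_square_deviation_shift:
  fixes f :: "'b \<Rightarrow> real"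
  assumes "finite S" "S \<noteq> {}"
  shows "(\<Sum>p\<in>S. (f p - a)\<^sup>2) =
    (\<Sum>p\<in>S. (f p - (\<Sum>q\<in>S. f q) / card S)\<^sup>2) + card S * ((\<Sum>q\<in>S. f q) / card S - a)\<^sup>2"
proof -
  define m where "m = (\<Sum>q\<in>S. f q) / card S"
  have c: "real (card S) \<noteq> 0" using assms by simp
  have z: "(\<Sum>p\<in>S. f p - m) = 0"
    using c by (simp add: sum_subtractf m_def)
  have "(\<Sum>p\<in>S. (f p - a)\<^sup>2) = (\<Sum>p\<in>S. (f p - m)\<^sup>2 + 2 * (m - a) * (f p - m) + (m - a)\<^sup>2)"
    by (intro sum.cong refl) (simp add: power2_eq_square algebra_simps)
  also have "\<dots> = (\<Sum>p\<in>S. (f p - m)\<^sup>2) + card S * (m - a)\<^sup>2"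
    using z by (simp add: sum.distrib flip: sum_distrib_left)
  finally show ?thesis unfolding m_def .
qed

text \<open>Induction on \<open>card A\<close> by the law of total variance, conditioning on the
  first entry. The induction hypothesis bounds the spread inside each fibre. The conditional means
  lie within \<open>c\<close> of each other, so each exposed entry adds at most the square of
  \<open>c\<close>. The sum of squares is not normalised, whence the factor
  \<open>fact (card A)\<close>.\<close>

lemma variance_permutations_of_set:
  fixes f :: "'a list \<Rightarrow> real"
  assumes "finite A"
    and "\<And>p x y. p \<in> permutations_of_set A \<Longrightarrow> x \<in> A \<Longrightarrow> y \<in> A \<Longrightarrow>
           \<bar>f (map (Transposition.transpose x y) p) - f p\<bar> \<le> c"
  shows "(\<Sum>p\<in>permutations_of_set A. (f p - (\<Sum>q\<in>permutations_of_set A. f q) / fact (card A))\<^sup>2)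
     \<le> c\<^sup>2 * card A * fact (card A)"
  using assms
proof (induction "card A" arbitrary: A f)
  case 0
  then show ?case by simp
next
  case (Suc m)
  define mu where "mu x = (\<Sum>q\<in>permutations_of_set (A - {x}). f (x # q)) / fact m" for x
  define M where "M = (\<Sum>q\<in>permutations_of_set A. f q) / fact (card A)"
  have ne: "A \<noteq> {}" using Suc by auto
  have cm: "card (A - {x}) = m" if "x \<in> A" for x using that Suc by simp
  \<comment> \<open>The transposition of \<open>x\<close> and \<open>y\<close> maps the permutations
    starting with \<open>x\<close> bijectively to those starting with \<open>y\<close>, and
    \<open>f\<close> changes by at most \<open>c\<close> along each matched pair.\<close>
  have mu_close: "mu y - mu x \<le> c" if "x \<in> A" "y \<in> A" for x y
  proof -
    let ?t = "Transposition.transpose x y"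
    have img: "?t ` (A - {x}) = A - {y}"
      using that by (auto simp: Transposition.transpose_def image_iff)
    have "(\<Sum>q\<in>permutations_of_set (A - {y}). f (y # q)) =
          (\<Sum>q\<in>map ?t ` permutations_of_set (A - {x}). f (y # q))"
      by (simp flip: img permutations_of_set_image_inj)
    also have "\<dots> = (\<Sum>q\<in>permutations_of_set (A - {x}). f (y # map ?t q))"
      by (subst sum.reindex) (auto intro: inj_on_subset[OF inj_mapI])
    also have "\<dots> \<le> (\<Sum>q\<in>permutations_of_set (A - {x}). f (x # q) + c)"
    proof (rule sum_mono)
      fix q assume q: "q \<in> permutations_of_set (A - {x})"
      have "x # q \<in> permutations_of_set A"
        using q that by (auto simp: permutations_of_set_def)
      from Suc.prems(2)[OF this that] show "f (y # map ?t q) \<le> f (x # q) + c"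
        by simp
    qed
    also have "\<dots> = (\<Sum>q\<in>permutations_of_set (A - {x}). f (x # q)) + fact m * c"
      using cm[OF that(1)] Suc.prems(1) by (simp add: sum.distrib)
    finally show ?thesis
      unfolding mu_def by (simp add: field_simps)
  qed
  have M_avg: "M = (\<Sum>x\<in>A. mu x) / card A"
    unfolding M_def mu_def sum_permutations_of_set_Cons[OF Suc.prems(1) ne]
    by (simp add: field_simps flip: sum_divide_distrib Suc(2))
  have mu_M: "(mu x - M)\<^sup>2 \<le> c\<^sup>2" if "x \<in> A" for x
  proof -
    \<comment> \<open>\<open>M\<close> is the average of the conditional means, so its distance to
      one of them is an average of differences bounded by \<open>c\<close>.\<close>
    have "mu x - M = (\<Sum>y\<in>A. mu x - mu y) / card A"
      using M_avg ne Suc.prems(1) by (simp add: sum_subtractf field_simps)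
    also have "\<bar>\<dots>\<bar> \<le> (\<Sum>y\<in>A. c) / card A"
    proof -
      have "\<bar>mu x - mu y\<bar> \<le> c" if "y \<in> A" for y
        using mu_close[OF that \<open>x \<in> A\<close>] mu_close[OF \<open>x \<in> A\<close> that] by linarith
      hence "\<bar>\<Sum>y\<in>A. mu x - mu y\<bar> \<le> (\<Sum>y\<in>A. c)"
        by (intro order.trans[OF sum_abs] sum_mono)
      thus ?thesis unfolding abs_divide abs_of_nat by (rule divide_right_mono) simp
    qed
    also have "\<dots> = c" using ne Suc.prems(1) by simp
    finally show ?thesis by (metis abs_ge_zero abs_le_square_iff abs_of_nonneg order.trans)
  qed
  have "(\<Sum>p\<in>permutations_of_set A. (f p - M)\<^sup>2) =
        (\<Sum>x\<in>A. \<Sum>q\<in>permutations_of_set (A - {x}). (f (x # q) - M)\<^sup>2)"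
    by (rule sum_permutations_of_set_Cons[OF Suc.prems(1) ne])
  also have "\<dots> \<le> (\<Sum>x\<in>A. c\<^sup>2 * m * fact m + fact m * c\<^sup>2)"
  proof (rule sum_mono)
    fix x assume x: "x \<in> A"
    have cp: "card (permutations_of_set (A - {x})) = fact m"
      using cm[OF x] Suc.prems(1) by simp
    have "(\<Sum>q\<in>permutations_of_set (A - {x}). (f (x # q) - M)\<^sup>2) =
       (\<Sum>q\<in>permutations_of_set (A - {x}). (f (x # q) - mu x)\<^sup>2) + fact m * (mu x - M)\<^sup>2"
      using sum_square_deviation_shift[of "permutations_of_set (A - {x})" "\<lambda>q. f (x # q)" M]
        cp Suc.prems(1) by (simp add: mu_def)
    also have "(\<Sum>q\<in>permutations_of_set (A - {x}). (f (x # q) - mu x)\<^sup>2) \<le> c\<^sup>2 * m * fact m"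
    proof -
      \<comment> \<open>Swapping two symbols other than \<open>x\<close> leaves the head in place,
        so the hypothesis on \<open>f\<close> passes to the fibre.\<close>
      have "\<bar>f (x # map (Transposition.transpose u v) p) - f (x # p)\<bar> \<le> c"
        if p: "p \<in> permutations_of_set (A - {x})" and uv: "u \<in> A - {x}" "v \<in> A - {x}" for p u v
      proof -
        have "x # p \<in> permutations_of_set A"
          using p x by (auto simp: permutations_of_set_def)
        moreover have "Transposition.transpose u v x = x"
          using uv by (intro transpose_apply_other) auto
        ultimately show ?thesis using Suc.prems(2)[of "x # p" u v] uv by simp
      qed
      from Suc.hyps(1)[of "A - {x}" "\<lambda>q. f (x # q)", OF _ _ this] cm[OF x] Suc.prems(1)
      show ?thesis by (simp add: mu_def)
    qed
    also have "fact m * (mu x - M)\<^sup>2 \<le> fact m * c\<^sup>2"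
      using mu_M[OF x] by (intro mult_left_mono) auto
    finally show "(\<Sum>q\<in>permutations_of_set (A - {x}). (f (x # q) - M)\<^sup>2) \<le> c\<^sup>2 * m * fact m + fact m * c\<^sup>2"
      by simp
  qed
  also have "\<dots> = c\<^sup>2 * card A * fact (card A)"
    unfolding Suc(2)[symmetric] sum_constant by (simp add: algebra_simps)
  finally show ?case unfolding M_def .
qed

section \<open>Matchings of blocks\<close>

text \<open>A matching between position blocks and value blocks in which every edge carries a
  witness pair in its cell. Comparing \<open>fst\<close> components is enough, since both members of
  a pair share their blocks.\<close>

definition block_matching :: "nat \<Rightarrow> nat list \<Rightarrow> (nat \<times> nat) set \<Rightarrow> bool" where
  "block_matching L p M \<longleftrightarrow>
     (\<forall>(i, j)\<in>M. i < j \<and> j < length p \<and> i div L = j div L \<and> p ! i div L = p ! j div L) \<and>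
     (\<forall>e\<in>M. \<forall>e'\<in>M. e \<noteq> e' \<longrightarrow>
        fst e div L \<noteq> fst e' div L \<and> p ! fst e div L \<noteq> p ! fst e' div L)"

definition block_matching_number :: "nat \<Rightarrow> nat list \<Rightarrow> nat" where
  "block_matching_number L p = Max (card ` {M. block_matching L p M})"

lemma block_matching_subset:
  "block_matching L p M \<Longrightarrow> M \<subseteq> {..<length p} \<times> {..<length p}"
  unfolding block_matching_def by fastforce

lemma finite_block_matchings: "finite {M. block_matching L p M}"
  by (rule finite_subset[of _ "Pow ({..<length p} \<times> {..<length p})"])
     (use block_matching_subset in auto)

lemma card_le_block_matching_number:
  "block_matching L p M \<Longrightarrow> card M \<le> block_matching_number L p"
  unfolding block_matching_number_def using finite_block_matchings by (intro Max_ge) auto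

lemma block_matching_number_attained:
  obtains M where "block_matching L p M" "card M = block_matching_number L p"
proof -
  have "block_matching L p {}" by (simp add: block_matching_def)
  hence "Max (card ` {M. block_matching L p M}) \<in> card ` {M. block_matching L p M}"
    using finite_block_matchings by (intro Max_in) auto
  thus ?thesis using that unfolding block_matching_number_def by auto
qed

section \<open>Twins from a block matching\<close>

lemma nths_eq_map_nth: "nths p I = map ((!) p) (filter (\<lambda>i. i \<in> I) [0..<length p])"
proof -
  have *: "zip p [0..<length p] = map (\<lambda>i. (p ! i, i)) [0..<length p]"
    by (rule nth_equalityI) auto
  show ?thesis
    unfolding nths_def * filter_map by (simp add: comp_def)
qed

text \<open>Filtering all positions by a set lists that set increasingly. Twins can thus be given by
  increasing lists of positions instead of index sets.\<close>

lemma nths_strict_sorted: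
  assumes "sorted_wrt (<) us" "set us \<subseteq> {..<length p}"
  shows "nths p (set us) = map ((!) p) us"
proof -
  have "filter (\<lambda>i. i \<in> set us) [0..<length p] = us"
    using assms by (intro strict_sorted_equal) (auto simp: sorted_wrt_filter)
  thus ?thesis by (simp add: nths_eq_map_nth)
qed

lemma less_of_div_less: "(a::nat) div L < b div L \<Longrightarrow> a < b"
  by (meson div_le_mono leD leI)

text \<open>Between different blocks a comparison is decided by the block indices alone. Applied to
  positions this keeps the second members in order; applied to values it gives
  order-isomorphism.\<close>

lemma less_iff_less_of_same_blocks:
  fixes a b a' b' L :: nat
  assumes "a div L = a' div L" "b div L = b' div L" "a div L \<noteq> b div L"
  shows "a < b \<longleftrightarrow> a' < b'"
  using assms by (metis less_of_div_less linorder_neqE_nat order_less_asym)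

text \<open>The first members of the pairs form one twin, the second members the other. Distinct
  pairs occupy distinct value blocks, so both twins compare their entries in the same way.\<close>

lemma has_twins_of_block_matching:
  assumes M: "block_matching L p M" and p: "distinct p"
  shows "has_twins_of_length_ge p (card M)"
proof -
  have fin: "finite M" using block_matching_subset[OF M] finite_subset by blast
  have pair: "i < j \<and> j < length p \<and> i div L = j div L \<and> p ! i div L = p ! j div L"
    if "(i, j) \<in> M" for i j
    using M that unfolding block_matching_def by auto
  have sep: "fst e div L \<noteq> fst e' div L \<and> p ! fst e div L \<noteq> p ! fst e' div L"
    if "e \<in> M" "e' \<in> M" "e \<noteq> e'" for e e'
    using M that unfolding block_matching_def by blast
  have injf: "inj_on fst M" using sep by (metis inj_onI)
  \<comment> \<open>Lists \<open>M\<close> by increasing first member. \<open>inv_into\<close>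
    recovers a pair from its first member, as position blocks separate the pairs.\<close>
  define es where "es = map (inv_into M fst) (sorted_list_of_set (fst ` M))"
  have es: "set es = M" "sorted_wrt (\<lambda>e e'. fst e < fst e') es" "length es = card M"
  proof -
    show "set es = M" using fin injf by (simp add: es_def inv_into_image_cancel)
    show "length es = card M" using injf by (simp add: es_def card_image)
    have "map fst es = sorted_list_of_set (fst ` M)"
      using fin by (auto simp: es_def f_inv_into_f intro!: map_idI)
    hence "sorted_wrt (<) (map fst es)" by simp
    thus "sorted_wrt (\<lambda>e e'. fst e < fst e') es" by (simp add: sorted_wrt_map)
  qed
  have nthM: "es ! s \<in> M" if "s < length es" for s using that es(1) nth_mem by blast
  have dist: "es ! s \<noteq> es ! t" if "s < length es" "t < length es" "s \<noteq> t" for s t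
    using sorted_wrt_nth_less[OF es(2)] that by (metis less_irrefl linorder_neqE_nat)
  define us ws where "us = map fst es" and "ws = map snd es"
  have us1: "sorted_wrt (<) us" using es(2) by (simp add: us_def sorted_wrt_map)
  have ws1: "sorted_wrt (<) ws"
    unfolding sorted_wrt_iff_nth_less
  proof (intro allI impI)
    fix s t assume "s < t" "t < length ws"
    hence st: "s < t" "t < length es" by (auto simp: ws_def)
    have "fst (es ! s) < fst (es ! t)" using es(2) st by (auto simp: sorted_wrt_iff_nth_less)
    hence "snd (es ! s) < snd (es ! t)"
      using less_iff_less_of_same_blocks[of "fst (es ! s)" L "snd (es ! s)" "fst (es ! t)" "snd (es ! t)"]
        pair[of "fst (es ! s)" "snd (es ! s)"] pair[of "fst (es ! t)" "snd (es ! t)"]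
        nthM[of s] nthM[of t] sep[of "es ! s" "es ! t"] dist[of s t] st by auto
    thus "ws ! s < ws ! t" using st by (simp add: ws_def)
  qed
  have us2: "set us \<subseteq> {..<length p}" and ws2: "set ws \<subseteq> {..<length p}"
    using block_matching_subset[OF M] es(1) by (auto simp: us_def ws_def)
  have ni: "nths p (set us) = map ((!) p) us" and nj: "nths p (set ws) = map ((!) p) ws"
    using nths_strict_sorted us1 ws1 us2 ws2 by auto
  have disj: "set us \<inter> set ws = {}"
  proof -
    \<comment> \<open>A position used as first member of one pair and second member of another would
      put two different pairs into one position block.\<close>
    have False if "(i, j) \<in> M" "(k, i) \<in> M" for i j k
      using pair[OF that(1)] pair[OF that(2)] sep[OF that] by auto
    thus ?thesis using es(1) by (auto simp: us_def ws_def)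
  qed
  have "p ! i \<noteq> p ! j" if "i \<in> set us" "j \<in> set ws" for i j
  proof -
    have "i < length p" "j < length p" "i \<noteq> j" using that us2 ws2 disj by auto
    thus ?thesis using nth_eq_iff_index_eq[OF p] by simp
  qed
  hence d: "set (nths p (set us)) \<inter> set (nths p (set ws)) = {}"
    unfolding ni nj by auto
  have oi: "order_iso (nths p (set us)) (nths p (set ws))"
    unfolding order_iso_def ni nj
  proof (intro conjI allI impI)
    show "length (map ((!) p) us) = length (map ((!) p) ws)" by (simp add: us_def ws_def)
  next
    fix s t assume "s < length (map ((!) p) us)" "t < length (map ((!) p) us)"
    hence st: "s < length es" "t < length es" by (auto simp: us_def)
    show "(map ((!) p) us ! s < map ((!) p) us ! t) = (map ((!) p) ws ! s < map ((!) p) ws ! t)"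
    proof (cases "s = t")
      case False
      have "p ! fst (es ! s) < p ! fst (es ! t) \<longleftrightarrow> p ! snd (es ! s) < p ! snd (es ! t)"
        using pair[of "fst (es ! s)" "snd (es ! s)"] pair[of "fst (es ! t)" "snd (es ! t)"]
          nthM[of s] nthM[of t] sep[of "es ! s" "es ! t"] dist[of s t] st False
        by (intro less_iff_less_of_same_blocks[where L = L]) auto
      thus ?thesis using st by (simp add: us_def ws_def)
    qed simp
  qed
  show ?thesis unfolding has_twins_of_length_ge_def
    using us2 ws2 d oi es(3)
    by (intro exI[of _ "set us"] exI[of _ "set ws"]) (auto simp: ni nj, auto simp: us_def ws_def)
qed

section \<open>Effect of exchanging two values\<close>

text \<open>Only pairs containing the value \<open>x\<close> or \<open>y\<close> are disturbed. Each
  value meets at most one pair of a matching, so dropping at most two pairs leaves a matching of the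
  new list.\<close>

lemma block_matching_number_transpose_ge:
  assumes p: "distinct p"
  shows "block_matching_number L p \<le> block_matching_number L (map (Transposition.transpose x y) p) + 2"
proof -
  obtain M where M: "block_matching L p M" "card M = block_matching_number L p"
    using block_matching_number_attained by blast
  have fin: "finite M" using block_matching_subset[OF M(1)] finite_subset by blast
  define R where "R z = {e\<in>M. p ! fst e = z \<or> p ! snd e = z}" for z
  have R: "card (R z) \<le> 1" for z
  proof -
    have "e = e'" if "e \<in> R z" "e' \<in> R z" for e e'
    proof (rule ccontr)
      assume "e \<noteq> e'"
      moreover have "e \<in> M" "e' \<in> M" using that by (auto simp: R_def)
      \<comment> \<open>Both pairs would lie in the value block of \<open>z\<close>, which a
        matching forbids.\<close>
      moreover have "p ! fst e div L = z div L" "p ! fst e' div L = z div L"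
        using that M(1) unfolding R_def block_matching_def by force+
      ultimately show False using M(1) unfolding block_matching_def by force
    qed
    thus ?thesis using fin
      using card_le_Suc0_iff_eq[of "R z"] by (auto simp: R_def)
  qed
  let ?M = "M - (R x \<union> R y)"
  let ?q = "map (Transposition.transpose x y) p"
  have same: "?q ! fst e = p ! fst e \<and> ?q ! snd e = p ! snd e" if "e \<in> ?M" for e
  proof -
    have "fst e < length p" "snd e < length p"
      using that block_matching_subset[OF M(1)] by force+
    thus ?thesis using that by (auto simp: R_def Transposition.transpose_def)
  qed
  have "block_matching L ?q ?M"
    unfolding block_matching_def
  proof (intro conjI ballI impI)
    fix e assume e: "e \<in> ?M"
    show "case e of (i, j) \<Rightarrow> i < j \<and> j < length ?q \<and> i div L = j div L \<and> ?q ! i div L = ?q ! j div L"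
      using e same[OF e] M(1) unfolding block_matching_def by (cases e) auto
  next
    fix e e' assume e: "e \<in> ?M" "e' \<in> ?M" "e \<noteq> e'"
    show "fst e div L \<noteq> fst e' div L" "?q ! fst e div L \<noteq> ?q ! fst e' div L"
      using e same[OF e(1)] same[OF e(2)] M(1) unfolding block_matching_def by auto
  qed
  hence "card ?M \<le> block_matching_number L ?q" by (rule card_le_block_matching_number)
  moreover have "card M \<le> card ?M + card (R x \<union> R y)"
    by (rule order.trans[OF card_mono card_Un_le]) (use fin in \<open>auto simp: R_def\<close>)
  moreover have "card (R x \<union> R y) \<le> 2" using card_Un_le[of "R x" "R y"] R[of x] R[of y] by simp
  ultimately show ?thesis using M(2) by linarith
qed

text \<open>A transposition is an involution, so the one-sided bound applies in both
  directions.\<close>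

lemma block_matching_number_lipschitz:
  assumes "distinct p"
  shows "\<bar>real (block_matching_number L (map (Transposition.transpose x y) p)) - real (block_matching_number L p)\<bar> \<le> 2"
proof -
  have "distinct (map (Transposition.transpose x y) p)"
    using assms by (simp add: distinct_map)
  from block_matching_number_transpose_ge[OF this, of L x y] block_matching_number_transpose_ge[OF assms, of L x y]
  show ?thesis by (simp add: comp_def)
qed

section \<open>Counting patterns\<close>

text \<open>Ordered tuples, so that mapping \<open>(!) p\<close> over a tuple of positions yields
  the tuple of values found there.\<close>

definition distinct_lists :: "nat \<Rightarrow> 'a set \<Rightarrow> 'a list set" where
  "distinct_lists k U = {xs. length xs = k \<and> distinct xs \<and> set xs \<subseteq> U}"

lemma finite_distinct_lists [simp]: "finite U \<Longrightarrow> finite (distinct_lists k U)"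
  unfolding distinct_lists_def
  by (rule finite_subset[OF _ finite_lists_length_eq[of U k]]) auto

text \<open>Reading a permutation in an order that starts with \<open>us\<close> is a bijection on
  permutations that brings the prescribed entries to the front. What remains is to count
  permutations with the fixed prefix \<open>vs\<close>.\<close>

lemma card_permutations_with_entries:
  assumes A: "finite A" and us: "us \<in> distinct_lists k {..<card A}" and vs: "vs \<in> distinct_lists k A"
  shows "card {p \<in> permutations_of_set A. map ((!) p) us = vs} = fact (card A - k)"
proof -
  let ?P = "permutations_of_set A"
  define qs where "qs = us @ sorted_list_of_set ({..<card A} - set us)"
  have qs: "distinct qs" "set qs = {..<card A}"
    using us by (auto simp: qs_def distinct_lists_def)
  define h where "h p = map ((!) p) qs" for p :: "'a list"
  have P: "length p = card A" "distinct p" "set p = A" if "p \<in> ?P" for p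
    using that by (auto dest: permutations_of_setD length_finite_permutations_of_set)
  have sub: "h ` ?P \<subseteq> ?P"
  proof safe
    fix p assume p: "p \<in> ?P"
    have "set (h p) = (!) p ` {0..<length p}"
      by (simp add: h_def qs(2) P(1)[OF p] lessThan_atLeast0)
    hence "set (h p) = A" using P(3)[OF p] by (simp add: nth_image)
    moreover have "distinct (h p)"
      using P[OF p] qs by (auto simp: h_def distinct_map inj_on_def nth_eq_iff_index_eq)
    ultimately show "h p \<in> ?P" by blast
  qed
  have inj: "inj_on h ?P"
  proof (rule inj_onI)
    fix p q assume pq: "p \<in> ?P" "q \<in> ?P" "h p = h q"
    hence "\<forall>i<card A. p ! i = q ! i" using qs(2) by (auto simp: h_def)
    thus "p = q" using P[OF pq(1)] P[OF pq(2)] by (auto intro: nth_equalityI)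
  qed
  \<comment> \<open>An injective self-map of a finite set is surjective.\<close>
  have surj: "h ` ?P = ?P" using sub inj by (intro endo_inj_surj) auto
  have tk: "take k (h p) = map ((!) p) us" for p
    using us by (simp add: h_def qs_def distinct_lists_def)
  have "h ` {p \<in> ?P. map ((!) p) us = vs} = {r \<in> h ` ?P. take k r = vs}"
    using tk by auto
  hence "h ` {p \<in> ?P. map ((!) p) us = vs} = {r \<in> ?P. take k r = vs}"
    unfolding surj .
  hence "card {p \<in> ?P. map ((!) p) us = vs} = card {r \<in> ?P. take k r = vs}"
    using card_image[OF inj_on_subset[OF inj], of "{p \<in> ?P. map ((!) p) us = vs}"] by auto
  also have "{r \<in> ?P. take k r = vs} = (@) vs ` permutations_of_set (A - set vs)"
  proof (intro equalityI subsetI)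
    fix r assume r: "r \<in> {r \<in> ?P. take k r = vs}"
    hence eq: "vs @ drop k r = r" using append_take_drop_id[of k r] by simp
    have r': "set r = A" "distinct r" using r P(2,3)[of r] by auto
    have "set vs \<union> set (drop k r) = A" "distinct (vs @ drop k r)"
      using r' unfolding set_append[symmetric] eq by simp_all
    hence "drop k r \<in> permutations_of_set (A - set vs)"
      by (auto simp: permutations_of_set_def)
    thus "r \<in> (@) vs ` permutations_of_set (A - set vs)"
      using eq by (intro image_eqI[of _ _ "drop k r"]) simp_all
  next
    fix r assume "r \<in> (@) vs ` permutations_of_set (A - set vs)"
    thus "r \<in> {r \<in> ?P. take k r = vs}"
      using vs by (auto simp: permutations_of_set_def distinct_lists_def)
  qed
  also have "card \<dots> = fact (card A - k)"
    using vs A by (subst card_image) (auto simp: distinct_lists_def card_Diff_subset distinct_card inj_on_def)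
  finally show ?thesis .
qed

text \<open>Linearity of expectation in counting form. Any position tuple and value tuple are joined
  by the same number of permutations, so the position condition \<open>F\<close> and the value
  condition \<open>G\<close> decouple into a product.\<close>

lemma sum_permutations_card_patterns:
  assumes A: "finite A"
  shows "(\<Sum>p\<in>permutations_of_set A. card {us \<in> distinct_lists k {..<card A}. F us \<and> G (map ((!) p) us)})
     = card {us \<in> distinct_lists k {..<card A}. F us} * card {vs \<in> distinct_lists k A. G vs} * fact (card A - k)"
proof -
  let ?P = "permutations_of_set A" and ?F = "{us \<in> distinct_lists k {..<card A}. F us}"
    and ?G = "{vs \<in> distinct_lists k A. G vs}"
  have fF: "finite ?F" by simp
  have fG: "finite ?G" using A by simp
  have "(\<Sum>p\<in>?P. card {us \<in> distinct_lists k {..<card A}. F us \<and> G (map ((!) p) us)})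
      = (\<Sum>p\<in>?P. \<Sum>us\<in>?F. if G (map ((!) p) us) then 1 else 0)"
    using fF by (intro sum.cong refl) (simp add: sum.If_cases Int_def conj_ac)
  also have "\<dots> = (\<Sum>us\<in>?F. \<Sum>p\<in>?P. if G (map ((!) p) us) then 1 else 0)"
    by (rule sum.swap)
  also have "\<dots> = (\<Sum>us\<in>?F. card ?G * fact (card A - k))"
  proof (rule sum.cong[OF refl])
    fix xs assume xs: "xs \<in> ?F"
    have mem: "map ((!) p) xs \<in> distinct_lists k A" if "p \<in> ?P" for p
    proof -
      have p: "length p = card A" "distinct p" "set p = A"
        using that by (auto dest: permutations_of_setD length_finite_permutations_of_set)
      have "p ! i \<in> A" if "i < card A" for i using p that nth_mem by metis
      thus ?thesis
        using xs p by (auto simp: distinct_lists_def distinct_map inj_on_def nth_eq_iff_index_eq subset_iff)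
    qed
    have "(\<Sum>p\<in>?P. if G (map ((!) p) xs) then 1 else 0) = card {p \<in> ?P. G (map ((!) p) xs)}"
      by (simp add: sum.If_cases Int_def)
    \<comment> \<open>Splits by the value tuple found at \<open>xs\<close>; different tuples give
      disjoint classes.\<close>
    also have "{p \<in> ?P. G (map ((!) p) xs)} = (\<Union>vs\<in>?G. {p \<in> ?P. map ((!) p) xs = vs})"
      using mem by auto
    also have "card \<dots> = (\<Sum>vs\<in>?G. card {p \<in> ?P. map ((!) p) xs = vs})"
      using fG by (intro card_UN_disjoint) auto
    also have "\<dots> = (\<Sum>vs\<in>?G. fact (card A - k))"
      using xs by (intro sum.cong refl card_permutations_with_entries[OF A]) auto
    finally show "(\<Sum>p\<in>?P. if G (map ((!) p) xs) then 1 else 0) = card ?G * fact (card A - k)"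
      by simp
  qed
  also have "\<dots> = card ?F * card ?G * fact (card A - k)" by simp
  finally show ?thesis .
qed

section \<open>Counting tuples confined to blocks\<close>

definition same_block :: "nat \<Rightarrow> nat list \<Rightarrow> bool" where
  "same_block L xs \<longleftrightarrow> (\<forall>x\<in>set xs. \<forall>y\<in>set xs. x div L = y div L)"

text \<open>Meant for lists of length four that concatenate two pairs: it constrains the coordinate
  in which the two pairs may use different blocks.\<close>

definition paired_blocks :: "nat \<Rightarrow> nat list \<Rightarrow> bool" where
  "paired_blocks L xs \<longleftrightarrow> same_block L (take 2 xs) \<and> same_block L (drop 2 xs)"

text \<open>The first entry fixes the block, and each of the other \<open>k\<close> entries is then
  determined by its remainder modulo \<open>L\<close>.\<close>

lemma card_same_block_le:
  assumes "finite U" "L > 0"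
  shows "card {xs \<in> distinct_lists (Suc k) U. same_block L xs} \<le> card U * L ^ k"
proof -
  let ?Z = "{zs. set zs \<subseteq> {..<L} \<and> length zs = k}"
  have "{xs \<in> distinct_lists (Suc k) U. same_block L xs}
     \<subseteq> (\<lambda>(x, zs). x # map (\<lambda>z. x div L * L + z) zs) ` (U \<times> ?Z)"
  proof
    fix xs assume "xs \<in> {xs \<in> distinct_lists (Suc k) U. same_block L xs}"
    then obtain x ys where x: "xs = x # ys" "length ys = k" "x \<in> U" "\<forall>y\<in>set ys. x div L = y div L"
      by (auto simp: distinct_lists_def same_block_def length_Suc_conv)
    have "ys = map (\<lambda>z. x div L * L + z) (map (\<lambda>y. y mod L) ys)"
      using x(4) by (auto simp: comp_def intro!: map_idI[symmetric])
    moreover have "map (\<lambda>y. y mod L) ys \<in> ?Z" using x(2) assms(2) by auto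
    ultimately show "xs \<in> (\<lambda>(x, zs). x # map (\<lambda>z. x div L * L + z) zs) ` (U \<times> ?Z)"
      using x by (intro image_eqI[of _ _ "(x, map (\<lambda>y. y mod L) ys)"]) auto
  qed
  hence "card {xs \<in> distinct_lists (Suc k) U. same_block L xs} \<le> card (U \<times> ?Z)"
    using assms(1) finite_lists_length_eq[of "{..<L}" k] by (intro surj_card_le) auto
  also have "\<dots> = card U * L ^ k"
    by (simp add: card_cartesian_product card_lists_length_eq)
  finally show ?thesis .
qed

text \<open>Such a list is two same-block pairs joined, each chosen in at most
  \<open>card U * L\<close> ways.\<close>

lemma card_paired_blocks_le:
  assumes "finite U" "L > 0"
  shows "card {xs \<in> distinct_lists 4 U. paired_blocks L xs} \<le> (card U * L)\<^sup>2"
proof -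
  let ?B = "{xs \<in> distinct_lists 2 U. same_block L xs}"
  have B: "card ?B \<le> card U * L"
    using card_same_block_le[OF assms, of 1] by (simp add: numeral_2_eq_2)
  have "{xs \<in> distinct_lists 4 U. paired_blocks L xs} \<subseteq> (\<lambda>(a, b). a @ b) ` (?B \<times> ?B)"
  proof
    fix xs assume xs: "xs \<in> {xs \<in> distinct_lists 4 U. paired_blocks L xs}"
    hence "(take 2 xs, drop 2 xs) \<in> ?B \<times> ?B"
      by (auto simp: distinct_lists_def paired_blocks_def dest: in_set_takeD in_set_dropD)
    thus "xs \<in> (\<lambda>(a, b). a @ b) ` (?B \<times> ?B)" by (rule rev_image_eqI) simp
  qed
  hence "card {xs \<in> distinct_lists 4 U. paired_blocks L xs} \<le> card (?B \<times> ?B)"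
    using assms(1) by (intro surj_card_le) auto
  also have "\<dots> \<le> (card U * L)\<^sup>2"
    using B by (simp add: card_cartesian_product power2_eq_square mult_mono)
  finally show ?thesis .
qed

text \<open>Only the full blocks \<open>1\<close> to \<open>n div L - 1\<close> are used, and each
  realises every pair of remainders in \<open>R\<close>. Skipping block \<open>0\<close>, which
  contains the number \<open>0\<close>, lets the bound serve both positions \<open>{..<n}\<close>
  and values \<open>{1..n}\<close>. The choice of \<open>R\<close> covers both ordered and
  increasing pairs.\<close>

lemma card_same_block_pairs_ge:
  assumes U: "finite U" "{1..<n} \<subseteq> U" and L: "L > 0"
    and R: "R \<subseteq> {..<L} \<times> {..<L}" "\<And>r. (r, r) \<notin> R"
  shows "(n div L - 1) * card R
     \<le> card {xs \<in> distinct_lists 2 U. same_block L xs \<and> (xs ! 0 mod L, xs ! 1 mod L) \<in> R}"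
proof -
  define g where "g = (\<lambda>(b, r, s). [b * L + r, b * L + s])"
  have "card ({1..<n div L} \<times> R) \<le> card {xs \<in> distinct_lists 2 U. same_block L xs \<and> (xs ! 0 mod L, xs ! 1 mod L) \<in> R}"
  proof (rule card_inj_on_le)
    show "inj_on g ({1..<n div L} \<times> R)"
    proof (rule inj_onI)
      fix e e' assume e: "e \<in> {1..<n div L} \<times> R" "e' \<in> {1..<n div L} \<times> R" "g e = g e'"
      obtain b r s b' r' s' where bb: "e = (b, r, s)" "e' = (b', r', s')" by (metis surj_pair)
      have rs: "r < L" "s < L" "r' < L" "s' < L" using e R(1) bb by auto
      have eq: "b * L + r = b' * L + r'" "b * L + s = b' * L + s'" using e(3) bb by (auto simp: g_def)
      have "b = b'" using arg_cong[OF eq(1), of "\<lambda>x. x div L"] rs L by simp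
      thus "e = e'" using eq bb by simp
    qed
    show "g ` ({1..<n div L} \<times> R) \<subseteq> {xs \<in> distinct_lists 2 U. same_block L xs \<and> (xs ! 0 mod L, xs ! 1 mod L) \<in> R}"
    proof safe
      fix b r s assume b: "b \<in> {1..<n div L}" "(r, s) \<in> R"
      have rs: "r < L" "s < L" "r \<noteq> s" using b R by auto
      have "b * L + L \<le> (n div L) * L"
        using b mult_le_mono1[of "Suc b" "n div L" L] by simp
      also have "\<dots> \<le> n" by simp
      finally have "b * L + L \<le> n" .
      moreover have "b * L \<ge> 1" using b L by simp
      ultimately have "b * L + r \<in> {1..<n}" "b * L + s \<in> {1..<n}"
        unfolding atLeastLessThan_iff using rs by linarith+
      thus "g (b, r, s) \<in> distinct_lists 2 U" "same_block L (g (b, r, s))"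
        "(g (b, r, s) ! 0 mod L, g (b, r, s) ! 1 mod L) \<in> R"
        using U rs b L by (auto simp: g_def distinct_lists_def same_block_def)
    qed
  qed (use U in simp)
  thus ?thesis by (simp add: card_cartesian_product)
qed

lemma card_offdiagonal: "card (SIGMA r:{..<L}. {..<L} - {r}) = L * (L - 1)"
  by simp

lemma card_below_diagonal: "2 * card {(r, s). r < s \<and> s < (L::nat)} = L * (L - 1)"
proof -
  have "{(r, s). r < s \<and> s < L} = prod.swap ` (SIGMA s:{..<L}. {..<s})" by auto
  hence "card {(r, s). r < s \<and> s < L} = (\<Sum>s<L. s)"
    by (simp add: card_image)
  also have "2 * \<dots> = L * (L - 1)" by (induction L) (auto simp: algebra_simps)
  finally show ?thesis .
qed

section \<open>Good pairs and the obstructions to a matching\<close>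

text \<open>The brackets separate the condition on positions from the condition on values, the shape
  needed to compute the mean. Requiring increasing positions counts each pair once.\<close>

definition good_pairs :: "nat \<Rightarrow> nat list \<Rightarrow> nat list set" where
  "good_pairs L p = {us \<in> distinct_lists 2 {..<length p}.
     (same_block L us \<and> us ! 0 < us ! 1) \<and> same_block L (map ((!) p) us)}"

definition crowded_triples :: "nat \<Rightarrow> nat list \<Rightarrow> nat list set" where
  "crowded_triples L p = {us \<in> distinct_lists 3 {..<length p}.
     same_block L us \<and> same_block L (map ((!) p) us)}"

text \<open>Two disjoint pairs competing for one position block, each with its own value block. The
  order of the four positions is left free, an overcount that is harmless in an upper bound.\<close>

definition position_conflicts :: "nat \<Rightarrow> nat list \<Rightarrow> nat list set" where
  "position_conflicts L p = {us \<in> distinct_lists 4 {..<length p}.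
     same_block L us \<and> paired_blocks L (map ((!) p) us)}"

definition value_conflicts :: "nat \<Rightarrow> nat list \<Rightarrow> nat list set" where
  "value_conflicts L p = {us \<in> distinct_lists 4 {..<length p}.
     paired_blocks L us \<and> same_block L (map ((!) p) us)}"

lemma same_block_2: "same_block L [i, j] \<longleftrightarrow> i div L = j div L"
  by (auto simp: same_block_def)

lemma good_pairs_iff:
  "[i, j] \<in> good_pairs L p \<longleftrightarrow> i < j \<and> j < length p \<and> i div L = j div L \<and> p ! i div L = p ! j div L"
  by (auto simp: good_pairs_def distinct_lists_def same_block_2)

lemma good_pairsE:
  assumes "e \<in> good_pairs L p"
  obtains i j where "e = [i, j]" "i < j" "j < length p" "i div L = j div L" "p ! i div L = p ! j div L"
proof -
  obtain i j where "e = [i, j]"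
    using assms by (auto simp: good_pairs_def distinct_lists_def length_Suc_conv numeral_2_eq_2)
  thus ?thesis using that assms good_pairs_iff by blast
qed

text \<open>The pairs that share no block with another pair form a matching; each of the others extends
  either to three positions in a common cell or to a conflict of two disjoint pairs.\<close>

lemma card_good_pairs_le:
  "card (good_pairs L p) \<le> block_matching_number L p + card (crowded_triples L p)
     + card (position_conflicts L p) + card (value_conflicts L p)"
proof -
  let ?S = "good_pairs L p"
  \<comment> \<open>The good pairs that compete with no other good pair.\<close>
  define T where "T = {e\<in>?S. \<forall>e'\<in>?S. e \<noteq> e' \<longrightarrow>
     e ! 0 div L \<noteq> e' ! 0 div L \<and> p ! (e ! 0) div L \<noteq> p ! (e' ! 0) div L}"
  define g where "g = (\<lambda>e::nat list. (e ! 0, e ! 1))"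
  have fin: "finite ?S" "finite (crowded_triples L p)" "finite (position_conflicts L p)" "finite (value_conflicts L p)"
    by (auto simp: good_pairs_def crowded_triples_def position_conflicts_def value_conflicts_def)
  have inj: "inj_on g T"
    by (rule inj_onI) (auto simp: T_def g_def elim!: good_pairsE)
  have "block_matching L p (g ` T)"
    unfolding block_matching_def
  proof (intro conjI ballI impI)
    fix e assume "e \<in> g ` T"
    thus "case e of (i, j) \<Rightarrow> i < j \<and> j < length p \<and> i div L = j div L \<and> p ! i div L = p ! j div L"
      by (auto simp: T_def g_def elim!: good_pairsE)
  next
    fix e e' assume e: "e \<in> g ` T" "e' \<in> g ` T" "e \<noteq> e'"
    then obtain d d' where "d \<in> T" "d' \<in> T" "e = g d" "e' = g d'" "d \<noteq> d'" by blast
    thus "fst e div L \<noteq> fst e' div L" "p ! fst e div L \<noteq> p ! fst e' div L"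
      unfolding T_def by (auto simp: g_def)
  qed
  from card_le_block_matching_number[OF this] have T: "card T \<le> block_matching_number L p"
    by (simp add: card_image[OF inj])
  \<comment> \<open>Every discarded pair is the start of an obstructing list, so
    \<open>take 2\<close> shows that there are at most as many discarded pairs as
    obstructions.\<close>
  have "?S - T \<subseteq> take 2 ` crowded_triples L p \<union> (take 2 ` position_conflicts L p \<union> take 2 ` value_conflicts L p)"
  proof
    fix e assume "e \<in> ?S - T"
    then obtain e' where e: "e \<in> ?S" and e': "e' \<in> ?S" "e \<noteq> e'"
      and c: "e ! 0 div L = e' ! 0 div L \<or> p ! (e ! 0) div L = p ! (e' ! 0) div L"
      by (auto simp: T_def)
    from e obtain i j where ij: "e = [i, j]" "i < j" "j < length p" "i div L = j div L" "p ! i div L = p ! j div L"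
      by (rule good_pairsE)
    from e'(1) obtain k l where kl: "e' = [k, l]" "k < l" "l < length p" "k div L = l div L" "p ! k div L = p ! l div L"
      by (rule good_pairsE)
    show "e \<in> take 2 ` crowded_triples L p \<union> (take 2 ` position_conflicts L p \<union> take 2 ` value_conflicts L p)"
    proof (cases "{i, j} \<inter> {k, l} = {}")
      case True
      hence d: "[i, j, k, l] \<in> distinct_lists 4 {..<length p}"
        using ij kl by (auto simp: distinct_lists_def)
      have "[i, j, k, l] \<in> position_conflicts L p \<or> [i, j, k, l] \<in> value_conflicts L p"
        using c
      proof
        assume "e ! 0 div L = e' ! 0 div L"
        hence "same_block L [i, j, k, l]" "paired_blocks L (map ((!) p) [i, j, k, l])"
          using ij kl by (simp_all add: same_block_def paired_blocks_def)
        thus ?thesis using d by (simp add: position_conflicts_def)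
      next
        assume "p ! (e ! 0) div L = p ! (e' ! 0) div L"
        hence "paired_blocks L [i, j, k, l]" "same_block L (map ((!) p) [i, j, k, l])"
          using ij kl by (simp_all add: same_block_def paired_blocks_def)
        thus ?thesis using d by (simp add: value_conflicts_def)
      qed
      moreover have "e = take 2 [i, j, k, l]" using ij by simp
      ultimately show ?thesis by blast
    next
      case False
      \<comment> \<open>Two different increasing pairs that meet have a third position
        \<open>m\<close>. The shared position \<open>x\<close> ties \<open>m\<close> to the cell of
        \<open>i\<close> and \<open>j\<close>.\<close>
      have "k \<notin> {i, j} \<or> l \<notin> {i, j}"
        using ij(1,2) kl(1,2) e'(2) by auto
      then obtain m where m: "m \<in> {k, l}" "m \<notin> {i, j}" by blast
      obtain x where x: "x \<in> {i, j}" "x \<in> {k, l}" using False by blast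
      have "m div L = k div L" "p ! m div L = p ! k div L" "m < length p"
        using m(1) kl(2-5) by auto
      moreover have "x div L = k div L" "p ! x div L = p ! k div L"
        using x(2) kl(4,5) by auto
      moreover have "x div L = i div L" "p ! x div L = p ! i div L"
        using x(1) ij(4,5) by auto
      ultimately have "m < length p" "m div L = i div L" "p ! m div L = p ! i div L"
        by simp_all
      hence "[i, j, m] \<in> crowded_triples L p"
        using m ij(2-5)
        by (simp add: crowded_triples_def distinct_lists_def same_block_def)
      moreover have "e = take 2 [i, j, m]" using ij by simp
      ultimately show ?thesis by blast
    qed
  qed
  hence "card (?S - T) \<le> card (take 2 ` crowded_triples L p \<union> (take 2 ` position_conflicts L p \<union> take 2 ` value_conflicts L p))"
    using fin by (intro card_mono) auto
  also have "\<dots> \<le> card (crowded_triples L p) + (card (position_conflicts L p) + card (value_conflicts L p))"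
    using fin by (intro order.trans[OF card_Un_le] add_mono card_image_le)
  finally have "card (?S - T) \<le> card (crowded_triples L p) + (card (position_conflicts L p) + card (value_conflicts L p))" .
  moreover have "card ?S = card T + card (?S - T)"
    using card_Diff_subset[of T ?S] card_mono[of ?S T] fin(1) by (auto simp: T_def)
  ultimately show ?thesis using T by linarith
qed

section \<open>The mean and concentration\<close>

text \<open>The terms are asymptotic to \<open>1/8\<close>, \<open>0\<close> and \<open>1/16\<close>
  times \<open>n powr (2/3)\<close>, which leaves \<open>1/16\<close>, more than the required
  \<open>1/40\<close>. The latter is twice the target constant \<open>1/80\<close>.\<close>

lemma mean_asymptotics:
  "\<forall>\<^sub>F n in sequentially.
     (real n - n powr (1/3))\<^sup>2 * (n powr (1/3) - 4)\<^sup>2 / (8 * (real n * (real n - 1)))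
       - real n ^ 2 * (n powr (1/3)) ^ 4 / (16 * (real n * (real n - 1) * (real n - 2)))
       - real n ^ 3 * (n powr (1/3)) ^ 5 / (16 * (real n * (real n - 1) * (real n - 2) * (real n - 3)))
     \<ge> real n powr (2/3) / 40"
  by real_asymp

text \<open>Averages the bound on \<open>card (good_pairs L p)\<close>. The good pairs are counted
  from below through full blocks and the three kinds of obstruction from above.\<close>

lemma mean_block_matching_number_ge:
  fixes n L :: nat
  assumes n: "n \<ge> 4" and L: "L > 0" "2 * L \<le> n"
  shows "(\<Sum>p\<in>permutations_of_set {1..n}. real (block_matching_number L p)) / fact n
    \<ge> (real n - 2 * real L)\<^sup>2 * (real L - 1)\<^sup>2 / (2 * (real n * (real n - 1)))
       - real n ^ 2 * real L ^ 4 / (real n * (real n - 1) * (real n - 2))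
       - 2 * real n ^ 3 * real L ^ 5 / (real n * (real n - 1) * (real n - 2) * (real n - 3))"
proof -
  let ?P = "permutations_of_set {1..n}" and ?A = "{1..n}"
  have len: "length p = n" if "p \<in> ?P" for p
    using length_finite_permutations_of_set[OF that] by simp
  define a2 where "a2 = card {us \<in> distinct_lists 2 {..<n}. same_block L us \<and> us ! 0 < us ! 1}"
  define b2 where "b2 = card {vs \<in> distinct_lists 2 ?A. same_block L vs}"
  define s where "s k U = card {us \<in> distinct_lists k U. same_block L us}" for k U
  define q where "q U = card {us \<in> distinct_lists 4 U. paired_blocks L us}" for U
  have good: "(\<Sum>p\<in>?P. card (good_pairs L p)) = a2 * b2 * fact (n - 2)"
    using sum_permutations_card_patterns[of ?A 2 "\<lambda>us. same_block L us \<and> us ! 0 < us ! 1" "same_block L"]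
    by (simp add: good_pairs_def len a2_def b2_def cong: sum.cong)
  have crowded: "(\<Sum>p\<in>?P. card (crowded_triples L p)) = s 3 {..<n} * s 3 ?A * fact (n - 3)"
    using sum_permutations_card_patterns[of ?A 3 "same_block L" "same_block L"]
    by (simp add: crowded_triples_def len s_def cong: sum.cong)
  have pos: "(\<Sum>p\<in>?P. card (position_conflicts L p)) = s 4 {..<n} * q ?A * fact (n - 4)"
    using sum_permutations_card_patterns[of ?A 4 "same_block L" "paired_blocks L"]
    by (simp add: position_conflicts_def len s_def q_def cong: sum.cong)
  have val: "(\<Sum>p\<in>?P. card (value_conflicts L p)) = q {..<n} * s 4 ?A * fact (n - 4)"
    using sum_permutations_card_patterns[of ?A 4 "paired_blocks L" "same_block L"]
    by (simp add: value_conflicts_def len s_def q_def cong: sum.cong)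
  \<comment> \<open>At least \<open>n / L - 2\<close> blocks, each with \<open>L * (L - 1)\<close>
    ordered pairs of distinct elements, give \<open>m\<close> pairs.\<close>
  define m where "m = (real n - 2 * real L) * (real L - 1)"
  have m: "m \<ge> 0" using L by (simp add: m_def)
  have full: "m \<le> real ((n div L - 1) * (L * (L - 1)))"
  proof -
    have "n div L * L + n mod L = n" "n mod L < L" using L by auto
    hence "real (n div L) * real L \<ge> real n - real L"
      by (smt (verit) of_nat_add of_nat_less_iff of_nat_mult)
    moreover have "n div L \<ge> 1" using L by (simp add: Suc_le_eq div_greater_zero_iff)
    ultimately have "real n - 2 * real L \<le> real (n div L - 1) * real L"
      by (simp add: of_nat_diff algebra_simps)
    hence "m \<le> (real (n div L - 1) * real L) * (real L - 1)"
      unfolding m_def using L by (intro mult_right_mono) auto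
    also have "\<dots> = real ((n div L - 1) * (L * (L - 1)))"
      using L by (simp add: of_nat_diff mult_ac)
    finally show ?thesis .
  qed
  have b2: "m \<le> b2"
  proof -
    let ?R = "SIGMA r:{..<L}. {..<L} - {r}"
    have "(n div L - 1) * card ?R \<le>
       card {xs \<in> distinct_lists 2 ?A. same_block L xs \<and> (xs ! 0 mod L, xs ! 1 mod L) \<in> ?R}"
      using L by (intro card_same_block_pairs_ge) auto
    also have "\<dots> \<le> b2" unfolding b2_def by (intro card_mono) auto
    finally show ?thesis using full unfolding card_offdiagonal by linarith
  qed
  \<comment> \<open>Positions are taken in increasing order, so only half of the ordered pairs
    count.\<close>
  have a2: "m \<le> 2 * a2"
  proof -
    let ?R = "{(r, s). r < s \<and> s < L}"
    have "(n div L - 1) * card ?R \<le>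
       card {xs \<in> distinct_lists 2 {..<n}. same_block L xs \<and> (xs ! 0 mod L, xs ! 1 mod L) \<in> ?R}"
      using L by (intro card_same_block_pairs_ge) auto
    also have "\<dots> \<le> a2"
      unfolding a2_def
    proof (intro card_mono Collect_mono subsetI; clarsimp)
      fix xs assume xs: "xs \<in> distinct_lists 2 {..<n}" "same_block L xs"
        "xs ! 0 mod L < xs ! Suc 0 mod L"
      have "xs ! 0 div L = xs ! Suc 0 div L"
        using xs by (auto simp: same_block_def distinct_lists_def)
      thus "xs ! 0 < xs ! Suc 0"
        using xs(3) by (metis add_less_cancel_left mult_div_mod_eq)
    qed
    finally have "(n div L - 1) * (2 * card ?R) \<le> 2 * a2" by simp
    thus ?thesis using full unfolding card_below_diagonal by linarith
  qed
  have good_ge: "real (a2 * b2) \<ge> m\<^sup>2 / 2"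
    using mult_mono[OF a2 b2] m by (simp add: power2_eq_square)
  have s3: "s 3 {..<n} \<le> n * L ^ 2" "s 3 ?A \<le> n * L ^ 2"
    using card_same_block_le[of "{..<n}" L 2] card_same_block_le[of ?A L 2] L
    by (simp_all add: s_def numeral_3_eq_3 numeral_2_eq_2)
  have s4: "s 4 {..<n} \<le> n * L ^ 3" "s 4 ?A \<le> n * L ^ 3"
    using card_same_block_le[of "{..<n}" L 3] card_same_block_le[of ?A L 3] L
    by (simp_all add: s_def)
  have q: "q {..<n} \<le> (n * L)\<^sup>2" "q ?A \<le> (n * L)\<^sup>2"
    using card_paired_blocks_le[of "{..<n}" L] card_paired_blocks_le[of ?A L] L
    by (simp_all add: q_def)
  have c3: "real (s 3 {..<n} * s 3 ?A) \<le> real n ^ 2 * real L ^ 4"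
  proof -
    have "s 3 {..<n} * s 3 ?A \<le> (n * L ^ 2) * (n * L ^ 2)" using s3 by (intro mult_mono) auto
    also have "\<dots> = n ^ 2 * L ^ 4" by (simp add: power2_eq_square power4_eq_xxxx)
    finally show ?thesis by (metis of_nat_le_iff of_nat_mult of_nat_power)
  qed
  have c4: "real (s 4 {..<n} * q ?A) \<le> real n ^ 3 * real L ^ 5" "real (q {..<n} * s 4 ?A) \<le> real n ^ 3 * real L ^ 5"
  proof -
    have eq: "(n * L ^ 3) * (n * L)\<^sup>2 = n ^ 3 * L ^ 5" by (simp add: eval_nat_numeral)
    have "s 4 {..<n} * q ?A \<le> n ^ 3 * L ^ 5"
      unfolding eq[symmetric] using s4 q by (intro mult_mono) auto
    thus "real (s 4 {..<n} * q ?A) \<le> real n ^ 3 * real L ^ 5"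
      by (metis of_nat_le_iff of_nat_mult of_nat_power)
    have "q {..<n} * s 4 ?A \<le> n ^ 3 * L ^ 5"
      unfolding eq[symmetric] mult.commute[of "q _"] using s4 q by (intro mult_mono) auto
    thus "real (q {..<n} * s 4 ?A) \<le> real n ^ 3 * real L ^ 5"
      by (metis of_nat_le_iff of_nat_mult of_nat_power)
  qed
  \<comment> \<open>Factoring \<open>fact n\<close> lets the factorials of the pattern counts
    cancel, leaving falling factorials as denominators.\<close>
  have f2: "fact n = real n * (real n - 1) * fact (n - 2)"
    using n fact_reduce[of n, where ?'a = real] fact_reduce[of "n - 1", where ?'a = real]
    by (simp add: of_nat_diff numeral_2_eq_2)
  have f3: "fact n = real n * (real n - 1) * (real n - 2) * fact (n - 3)"
    unfolding f2 using n fact_reduce[of "n - 2", where ?'a = real]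
    by (simp add: of_nat_diff numeral_3_eq_3)
  have f4: "fact n = real n * (real n - 1) * (real n - 2) * (real n - 3) * fact (n - 4)"
    unfolding f3 using n fact_reduce[of "n - 3", where ?'a = real]
    by (simp add: of_nat_diff)
  have "(\<Sum>p\<in>?P. card (good_pairs L p)) \<le>
        (\<Sum>p\<in>?P. block_matching_number L p + card (crowded_triples L p)
     + card (position_conflicts L p) + card (value_conflicts L p))"
    by (intro sum_mono card_good_pairs_le)
  hence "real (\<Sum>p\<in>?P. block_matching_number L p) \<ge> 
       real (a2 * b2) * fact (n - 2) - real (s 3 {..<n} * s 3 ?A) * fact (n - 3)
        - real (s 4 {..<n} * q ?A) * fact (n - 4) - real (q {..<n} * s 4 ?A) * fact (n - 4)"
    unfolding sum.distrib good crowded pos val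
    by (smt (verit) of_nat_add of_nat_fact of_nat_le_iff of_nat_mult)
  also have "real (a2 * b2) * fact (n - 2) - real (s 3 {..<n} * s 3 ?A) * fact (n - 3)
        - real (s 4 {..<n} * q ?A) * fact (n - 4) - real (q {..<n} * s 4 ?A) * fact (n - 4) \<ge>
      m\<^sup>2 / 2 * fact (n - 2) - real n ^ 2 * real L ^ 4 * fact (n - 3)
        - real n ^ 3 * real L ^ 5 * fact (n - 4) - real n ^ 3 * real L ^ 5 * fact (n - 4)"
    using good_ge c3 c4 by (intro diff_mono mult_right_mono) auto
  finally have "(m\<^sup>2 / 2 * fact (n - 2) - real n ^ 2 * real L ^ 4 * fact (n - 3)
        - 2 * real n ^ 3 * real L ^ 5 * fact (n - 4)) / fact n 
      \<le> (\<Sum>p\<in>?P. real (block_matching_number L p)) / fact n"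
    by (intro divide_right_mono) (simp_all add: mult_ac)
  moreover have "m\<^sup>2 / 2 * fact (n - 2) / fact n = m\<^sup>2 / (2 * (real n * (real n - 1)))"
    unfolding f2 using mult_divide_mult_cancel_right[of "fact (n - 2)" "m\<^sup>2 / 2"] by simp
  moreover have "real n ^ 2 * real L ^ 4 * fact (n - 3) / fact n =
      real n ^ 2 * real L ^ 4 / (real n * (real n - 1) * (real n - 2))"
    unfolding f3 by (rule mult_divide_mult_cancel_right) simp
  moreover have "2 * real n ^ 3 * real L ^ 5 * fact (n - 4) / fact n =
      2 * real n ^ 3 * real L ^ 5 / (real n * (real n - 1) * (real n - 2) * (real n - 3))"
    unfolding f4 by (rule mult_divide_mult_cancel_right) simp
  ultimately show ?thesis
    unfolding m_def power_mult_distrib diff_divide_distrib by linarith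
qed

text \<open>Chebyshev's inequality: with mean at least \<open>2 * t\<close>, a matching number below
  \<open>t\<close> deviates from the mean by more than \<open>t\<close>, while the Lipschitz
  constant \<open>2\<close> bounds the variance by \<open>4 * n\<close>.\<close>

lemma twin_prob_ge:
  fixes L :: nat
  assumes n: "n > 0" and t: "t = real n powr (2/3) / 80"
    and mean: "2 * t \<le> (\<Sum>p\<in>permutations_of_set {1..n}. real (block_matching_number L p)) / fact n"
  shows "twin_prob n \<ge> 1 - 4 * real n / t\<^sup>2"
proof -
  let ?P = "permutations_of_set {1..n}" and ?f = "\<lambda>p. real (block_matching_number L p)"
  define mu where "mu = (\<Sum>p\<in>?P. ?f p) / fact n"
  define B where "B = {p\<in>?P. ?f p < t}"
  have tpos: "t > 0" unfolding t using n by simp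
  have dist: "distinct p" if "p \<in> ?P" for p using that by (rule permutations_of_setD)
  \<comment> \<open>Each bad permutation contributes at least the square of \<open>t\<close> to the
    total squared deviation.\<close>
  have "real (card B) * t\<^sup>2 = (\<Sum>p\<in>B. t\<^sup>2)" by simp
  also have "\<dots> \<le> (\<Sum>p\<in>B. (?f p - mu)\<^sup>2)"
  proof (rule sum_mono)
    fix p assume "p \<in> B"
    hence "t \<le> mu - ?f p" using mean by (simp add: B_def mu_def)
    thus "t\<^sup>2 \<le> (?f p - mu)\<^sup>2" using tpos by (subst power2_commute) (intro power_mono, auto)
  qed
  also have "\<dots> \<le> (\<Sum>p\<in>?P. (?f p - mu)\<^sup>2)"
    by (intro sum_mono2) (auto simp: B_def)
  also have "\<dots> \<le> 2\<^sup>2 * card {1..n} * fact (card {1..n})"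
    using variance_permutations_of_set[of "{1..n}" ?f 2] block_matching_number_lipschitz dist
    by (simp add: mu_def)
  finally have B: "real (card B) / fact n \<le> 4 * real n / t\<^sup>2"
    using tpos by (simp add: field_simps)
  have "?P - B \<subseteq> {p \<in> ?P. has_twins_of_length_ge p t}"
  proof safe
    fix p assume p: "p \<in> ?P" "p \<notin> B"
    obtain M where M: "block_matching L p M" "card M = block_matching_number L p"
      using block_matching_number_attained by blast
    have "t \<le> real (card M)" using p M(2) by (simp add: B_def)
    thus "has_twins_of_length_ge p t"
      using has_twins_of_block_matching[OF M(1) dist[OF p(1)]]
      unfolding has_twins_of_length_ge_def by (meson order.trans)
  qed
  hence "card (?P - B) \<le> card {p \<in> ?P. has_twins_of_length_ge p t}" by (intro card_mono) auto
  moreover have "card ?P = card B + card (?P - B)"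
    using card_Int_Diff[of ?P B] by (simp add: B_def Int_def conj_ac cong: conj_cong)
  moreover have "real (card ?P) = fact n" by simp
  ultimately have "real (card {p \<in> ?P. has_twins_of_length_ge p t}) \<ge> fact n - real (card B)"
    by linarith
  hence "real (card {p \<in> ?P. has_twins_of_length_ge p t}) / fact n \<ge> (fact n - real (card B)) / fact n"
    by (intro divide_right_mono) auto
  thus ?thesis using B by (simp add: twin_prob_def t diff_divide_distrib)
qed

lemma twin_prob_le_1: "twin_prob n \<le> 1"
proof -
  have "card {p \<in> permutations_of_set {1..n}. has_twins_of_length_ge p (real n powr (2/3) / 80)}
      \<le> card (permutations_of_set {1..n})"
    by (intro card_mono) auto
  thus ?thesis
    unfolding twin_prob_def by (intro divide_le_eq_1_pos[THEN iffD2] of_nat_mono) simp_all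
qed

theorem theorem2:
  shows "twin_prob \<longlonglongrightarrow> 1"
proof (rule tendsto_sandwich)
  show "\<forall>\<^sub>F n in sequentially. twin_prob n \<le> 1" by (simp add: twin_prob_le_1)
  \<comment> \<open>The error is \<open>25600 * n powr (-1/3)\<close>.\<close>
  show "(\<lambda>n. 1 - 4 * real n / (real n powr (2/3) / 80)\<^sup>2) \<longlonglongrightarrow> 1" by real_asymp
  have "\<forall>\<^sub>F n in sequentially. real n powr (1/3) \<ge> 4" by real_asymp
  moreover have "\<forall>\<^sub>F n in sequentially. real n powr (1/3) \<le> real n" by real_asymp
  ultimately show "\<forall>\<^sub>F n in sequentially. 1 - 4 * real n / (real n powr (2/3) / 80)\<^sup>2 \<le> twin_prob n"
    using mean_asymptotics eventually_ge_at_top[of 4]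
  proof eventually_elim
    case (elim n)
    define a where "a = real n powr (1/3)"
    \<comment> \<open>With \<open>L\<close> near \<open>c * a\<close> the mean is about
      \<open>c^2/2 - 2 * c^5\<close> times the square of \<open>a\<close>, positive for
      \<open>c^3 < 1/4\<close>; here \<open>c = 1/2\<close>.\<close>
    define L where "L = nat \<lfloor>a / 2\<rfloor>"
    have a: "a \<ge> 4" "a \<le> real n" using elim by (auto simp: a_def)
    have L: "real L \<le> a / 2" "a / 2 - 1 \<le> real L" using a by (auto simp: L_def) linarith+
    have n: "n \<ge> 4" by fact
    have pos: "real n > 0" "real n - 1 > 0" "real n - 2 > 0" "real n - 3 > 0" using n by auto
    have "real (2 * L) \<le> real n" "real L > 0" using L a by auto
    hence "2 * L \<le> n" "L > 0" by linarith+
    note mean_block_matching_number_ge[OF n this(2,1)]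
    \<comment> \<open>The bounds \<open>4 \<le> a\<close> and \<open>a \<le> n\<close> make both
      bases nonnegative, so squaring preserves the estimates.\<close>
    moreover have "(real n - 2 * real L)\<^sup>2 * (real L - 1)\<^sup>2 / (2 * (real n * (real n - 1)))
      \<ge> (real n - a)\<^sup>2 * (a / 2 - 2)\<^sup>2 / (2 * (real n * (real n - 1)))"
      using L a pos by (intro divide_right_mono mult_mono power_mono) auto
    moreover have "(real n - a)\<^sup>2 * (a / 2 - 2)\<^sup>2 / (2 * (real n * (real n - 1)))
       = (real n - a)\<^sup>2 * (a - 4)\<^sup>2 / (8 * (real n * (real n - 1)))"
    proof -
      have eq: "(a / 2 - 2)\<^sup>2 = (a - 4)\<^sup>2 / 4" by (simp add: power2_eq_square field_simps)
      show ?thesis unfolding eq by simp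
    qed
    moreover have "real n ^ 2 * real L ^ 4 / (real n * (real n - 1) * (real n - 2))
       \<le> real n ^ 2 * (a / 2) ^ 4 / (real n * (real n - 1) * (real n - 2))"
      using L a pos by (intro divide_right_mono mult_left_mono power_mono) auto
    moreover have "real n ^ 2 * (a / 2) ^ 4 / (real n * (real n - 1) * (real n - 2))
       = real n ^ 2 * a ^ 4 / (16 * (real n * (real n - 1) * (real n - 2)))"
      by (simp add: power_divide)
    moreover have "2 * real n ^ 3 * real L ^ 5 / (real n * (real n - 1) * (real n - 2) * (real n - 3))
       \<le> 2 * real n ^ 3 * (a / 2) ^ 5 / (real n * (real n - 1) * (real n - 2) * (real n - 3))"
      using L a pos by (intro divide_right_mono mult_left_mono power_mono) auto
    moreover have "2 * real n ^ 3 * (a / 2) ^ 5 / (real n * (real n - 1) * (real n - 2) * (real n - 3))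
       = real n ^ 3 * a ^ 5 / (16 * (real n * (real n - 1) * (real n - 2) * (real n - 3)))"
      by (simp add: power_divide)
    moreover note elim(3)[folded a_def]
    ultimately have "real n powr (2/3) / 40 \<le>
        (\<Sum>p\<in>permutations_of_set {1..n}. real (block_matching_number L p)) / fact n"
      by linarith
    thus ?case
      using n by (intro twin_prob_ge[of n _ L]) auto
  qed
qed simp

end
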